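(* Let $k=\mathbf{C}$ and let $n$ be a positive integer. For $\lambda=(\lambda_1,\dots,\lambda_{2n})\in k^{2n}$ let $X_\lambda$ be the germ at the origin of the hypersurface in $k^4$ (coordinates $x,y,z,w$) defined by $$F_\lambda=x^2+y^3+\sum_{i=1}^{2n}\lambda_iy^2(-w)^i+z^2w+yw^{2n+1}-\sum_{i=1}^{2n}\lambda_i(-w)^{i+2n+1}=0 .$$ Define a stratification $\{\Sigma_i\}_{i=0}^{2n}$ of the affine $\lambda$-space $k^{2n}$ by $\Sigma_0=\{0\}$ and $\Sigma_i=\{\lambda\mid\min\{j\mid\lambda_j\neq0\}=i\}$ for $i>0$. Then $X_\lambda\cong X_{\lambda'}$ whenever $\lambda,\lambda'\in\Sigma_i$ for a fixed $i$.
   Context: Isomorphism means isomorphism of (complex analytic) germs of hypersurface singularities at the origin, i.e. biholomorphic equivalence. *)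

theory Defs
  imports "HOL-Analysis.Analysis"
begin

section \<open>Holomorphic maps in several complex variables\<close>

text \<open>A function on an open subset of \<open>\<complex>\<^sup>m\<close> is holomorphic if at every point it has a Frechet
  derivative that is \<open>\<complex>\<close>-linear (real linearity is part of \<open>has_derivative\<close>).\<close>

definition mholomorphic_on :: "(complex ^ 'm \<Rightarrow> complex) \<Rightarrow> (complex ^ 'm) set \<Rightarrow> bool"
    (infix "mholomorphic'_on" 50) where
  "f mholomorphic_on U \<longleftrightarrow>
     (\<forall>v\<in>U. \<exists>D. (f has_derivative D) (at v) \<and> (\<forall>c u. D (c *s u) = c * D u))"

definition biholomorphic_map ::
    "(complex ^ 'm) set \<Rightarrow> (complex ^ 'm) set \<Rightarrow> (complex ^ 'm \<Rightarrow> complex ^ 'm) \<Rightarrow> bool" where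
  "biholomorphic_map U V \<phi> \<longleftrightarrow>
     open U \<and> open V \<and> bij_betw \<phi> U V \<and>
     (\<forall>i. (\<lambda>v. \<phi> v $ i) mholomorphic_on U) \<and>
     (\<forall>i. (\<lambda>v. inv_into U \<phi> v $ i) mholomorphic_on V)"

section \<open>Germs of hypersurfaces at the origin\<close>

text \<open>Elements of the local ring \<open>\<O>\<close> of \<open>\<complex>\<^sup>m\<close> at the origin are represented by functions that are
  holomorphic on some neighbourhood of the origin; only their values near the origin matter.\<close>

definition holomorphic_at_0 :: "(complex ^ 'm \<Rightarrow> complex) \<Rightarrow> bool" where
  "holomorphic_at_0 f \<longleftrightarrow> (\<exists>U. open U \<and> 0 \<in> U \<and> f mholomorphic_on U)"

text \<open>The germ of the complex space \<open>F = 0\<close> is given by its ideal \<open>F \<O>\<close>.\<close>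

definition hypersurface_germ :: "(complex ^ 'm \<Rightarrow> complex) \<Rightarrow> (complex ^ 'm \<Rightarrow> complex) set" where
  "hypersurface_germ F =
     {g. holomorphic_at_0 g \<and>
         (\<exists>h. holomorphic_at_0 h \<and> (\<forall>\<^sub>F v in nhds 0. g v = h v * F v))}"

text \<open>Biholomorphic equivalence of germs: a biholomorphic map between neighbourhoods of the
  origin, fixing the origin, whose pullback \<open>g \<mapsto> g \<circ> \<phi>\<close> identifies the ideal of \<open>Y\<close> with the
  ideal of \<open>X\<close>. For principal ideals \<open>F \<O>\<close> and \<open>G \<O>\<close> this says that \<open>G \<circ> \<phi>\<close> and \<open>F\<close> generate the
  same ideal; in particular \<open>\<phi>\<close> maps the zero set of \<open>F\<close> onto that of \<open>G\<close> near the origin.\<close>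

definition germ_isomorphic ::
    "(complex ^ 'm \<Rightarrow> complex) set \<Rightarrow> (complex ^ 'm \<Rightarrow> complex) set \<Rightarrow> bool" where
  "germ_isomorphic X Y \<longleftrightarrow>
     (\<exists>\<phi> U V. biholomorphic_map U V \<phi> \<and> 0 \<in> U \<and> 0 \<in> V \<and> \<phi> 0 = 0 \<and>
        (\<forall>g. holomorphic_at_0 g \<longrightarrow> (g \<in> Y \<longleftrightarrow> g \<circ> \<phi> \<in> X)))"

section \<open>The family and the stratification\<close>

text \<open>The affine space \<open>\<complex>\<^bsup>2n\<^esup>\<close>, with coordinates indexed by \<open>1, \<dots>, 2n\<close>.\<close>

definition param_space :: "nat \<Rightarrow> (nat \<Rightarrow> complex) set" where
  "param_space n = {1..2 * n} \<rightarrow>\<^sub>E UNIV"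

definition F_fam :: "nat \<Rightarrow> (nat \<Rightarrow> complex) \<Rightarrow> complex ^ 4 \<Rightarrow> complex" where
  "F_fam n l v =
     (let x = v $ 1; y = v $ 2; z = v $ 3; w = v $ 4 in
        x ^ 2 + y ^ 3 + (\<Sum>i = 1..2 * n. l i * y ^ 2 * (- w) ^ i) + z ^ 2 * w
          + y * w ^ (2 * n + 1) - (\<Sum>i = 1..2 * n. l i * (- w) ^ (i + 2 * n + 1)))"

definition X_fam :: "nat \<Rightarrow> (nat \<Rightarrow> complex) \<Rightarrow> (complex ^ 4 \<Rightarrow> complex) set" where
  "X_fam n l = hypersurface_germ (F_fam n l)"

definition stratum :: "nat \<Rightarrow> nat \<Rightarrow> (nat \<Rightarrow> complex) set" where
  "stratum n i =
     (if i = 0 then {l \<in> param_space n. \<forall>j\<in>{1..2 * n}. l j = 0}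
      else {l \<in> param_space n. (\<exists>j\<in>{1..2 * n}. l j \<noteq> 0) \<and> Min {j \<in> {1..2 * n}. l j \<noteq> 0} = i})"

lemma stratum_union: "(\<Union>i\<in>{0..2 * n}. stratum n i) = param_space n"
proof -
  have "\<exists>i\<in>{0..2 * n}. l \<in> stratum n i" if l: "l \<in> param_space n" for l
  proof (cases "\<forall>j\<in>{1..2 * n}. l j = 0")
    case True
    then have "l \<in> stratum n 0" using l by (simp add: stratum_def)
    then show ?thesis by auto
  next
    case False
    define S where "S = {j \<in> {1..2 * n}. l j \<noteq> 0}"
    have "Min S \<in> S" using False by (intro Min_in) (auto simp: S_def)
    moreover have "l \<in> stratum n (Min S)"
      using l False \<open>Min S \<in> S\<close> by (auto simp: stratum_def S_def)
    ultimately show ?thesis by (auto simp: S_def)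
  qed
  moreover have "stratum n i \<subseteq> param_space n" for i by (auto simp: stratum_def)
  ultimately show ?thesis by blast
qed

lemma stratum_disjoint: "i \<noteq> j \<Longrightarrow> stratum n i \<inter> stratum n j = {}"
  by (auto simp: stratum_def)

end

theory Submission
  imports Defs "HOL-Complex_Analysis.Conformal_Mappings"
begin

text \<open>
  Put \<open>p(w) = \<Sum>\<^sub>j \<lambda>\<^sub>j (-w)\<^sup>j\<close> and \<open>N = 2n + 1\<close>. The equation factors as
  \<open>F\<^sub>\<lambda> = x\<^sup>2 + z\<^sup>2 w + (y + p(w)) (y\<^sup>2 + w\<^sup>N)\<close>, so \<open>\<lambda>\<close> enters only through the polynomial \<open>p\<close>, and
  on the stratum of index \<open>i > 0\<close> one has \<open>p(w) = w\<^sup>i v(w)\<close> with \<open>v(0) \<noteq> 0\<close>. The stratum of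
  index \<open>0\<close> is a single point.

  Without the term \<open>p\<close> the polynomial is quasi-homogeneous: it is multiplied by \<open>r\<^bsup>6N\<^esup>\<close> under
  \<open>(x, y, z, w) \<mapsto> (r\<^bsup>3N\<^esup> x, r\<^bsup>2N\<^esup> y, r\<^bsup>3N-2\<^esup> z, r\<^sup>4 w)\<close>. The same computation is valid if \<open>r\<close> is a
  nonvanishing holomorphic function of \<open>w\<close>. If \<open>\<tau>(w) = w r(w)\<^sup>4\<close>, then this substitution turns
  \<open>y + p'(w)\<close> into \<open>r\<^bsup>2N\<^esup> y + r\<^bsup>4i\<^esup> w\<^sup>i v'(\<tau>(w))\<close>, and therefore it turns \<open>F\<^bsub>\<lambda>'\<^esub>\<close> into
  \<open>r\<^bsup>6N\<^esup> F\<^sub>\<lambda>\<close> as soon as \<open>r\<^bsup>4i\<^esup> v'(\<tau>(w)) = r\<^bsup>2N\<^esup> v(w)\<close>.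

  The parity of \<open>N\<close> gives \<open>4i \<noteq> 2N\<close>, and this is what makes the functional equation for \<open>r\<close>
  solvable. A power of \<open>v\<close> with exponent \<open>1/(4i - 2N)\<close> is a nonvanishing \<open>s\<close> with
  \<open>s\<^bsup>4i\<^esup> = v s\<^bsup>2N\<^esup>\<close>; take \<open>s'\<close> likewise for \<open>v'\<close>. The functions \<open>w s(w)\<^sup>4\<close> and \<open>w s'(w)\<^sup>4\<close> are local
  coordinates at \<open>0\<close>, and the change from one to the other is the required \<open>\<tau>\<close>, with
  \<open>r(w) = s(w) / s'(\<tau>(w))\<close> (lemma \<open>unit_matching_coordinate_change\<close>). The resulting substitution of
  four variables is biholomorphic because it is linear on the fibres of \<open>w\<close> and covers the
  biholomorphic map \<open>\<tau>\<close> (lemma \<open>biholomorphic_fibred_scaling\<close>). A biholomorphic map that carries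
  one equation to a unit multiple of the other identifies the two germs (lemma
  \<open>germ_isomorphic_if_pullback_unit_multiple\<close>).
\<close>

section \<open>Holomorphic functions of several variables\<close>

lemma mholomorphic_onI:
  assumes "\<And>v. v \<in> U \<Longrightarrow> (f has_derivative D v) (at v)"
    and "\<And>v c u. v \<in> U \<Longrightarrow> D v (c *s u) = c * D v u"
  shows "f mholomorphic_on U"
  using assms unfolding mholomorphic_on_def by blast

lemma mholomorphic_on_subset: "f mholomorphic_on U \<Longrightarrow> W \<subseteq> U \<Longrightarrow> f mholomorphic_on W"
  unfolding mholomorphic_on_def by blast

lemma mholomorphic_on_transform:
  assumes f: "f mholomorphic_on U" and "open U" and eq: "\<And>v. v \<in> U \<Longrightarrow> f v = g v"
  shows "g mholomorphic_on U"
  unfolding mholomorphic_on_def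
proof
  fix v assume v: "v \<in> U"
  obtain D where D: "(f has_derivative D) (at v)" "\<forall>c u. D (c *s u) = c * D u"
    using f v unfolding mholomorphic_on_def by blast
  have "(g has_derivative D) (at v)"
    by (rule has_derivative_transform_within_open[OF D(1) \<open>open U\<close> v eq])
  with D(2) show "\<exists>D. (g has_derivative D) (at v) \<and> (\<forall>c u. D (c *s u) = c * D u)"
    by blast
qed

lemma mholomorphic_on_mult:
  assumes "f mholomorphic_on U" and "g mholomorphic_on U"
  shows "(\<lambda>v. f v * g v) mholomorphic_on U"
  unfolding mholomorphic_on_def
proof
  fix v assume v: "v \<in> U"
  obtain D E where D: "(f has_derivative D) (at v)" "\<forall>c u. D (c *s u) = c * D u"
    and E: "(g has_derivative E) (at v)" "\<forall>c u. E (c *s u) = c * E u"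
    using assms v unfolding mholomorphic_on_def by blast
  have "((\<lambda>v. f v * g v) has_derivative (\<lambda>u. f v * E u + D u * g v)) (at v)"
    by (rule has_derivative_mult[OF D(1) E(1)])
  moreover have "\<forall>c u. f v * E (c *s u) + D (c *s u) * g v = c * (f v * E u + D u * g v)"
    by (simp add: D(2) E(2) algebra_simps)
  ultimately show "\<exists>D. ((\<lambda>v. f v * g v) has_derivative D) (at v) \<and> (\<forall>c u. D (c *s u) = c * D u)"
    by blast
qed

lemma mholomorphic_on_component: "(\<lambda>v. v $ i) mholomorphic_on U"
  by (rule mholomorphic_onI[where D = "\<lambda>_ u. u $ i"])
    (auto intro: bounded_linear_imp_has_derivative)

lemma mholomorphic_on_holomorphic_compose:
  assumes f: "f holomorphic_on S" and "open S" and g: "g mholomorphic_on U"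
    and sub: "\<And>v. v \<in> U \<Longrightarrow> g v \<in> S"
  shows "(\<lambda>v. f (g v)) mholomorphic_on U"
  unfolding mholomorphic_on_def
proof
  fix v assume v: "v \<in> U"
  obtain D where D: "(g has_derivative D) (at v)" "\<forall>c u. D (c *s u) = c * D u"
    using g v unfolding mholomorphic_on_def by blast
  have "(f has_derivative (*) (deriv f (g v))) (at (g v))"
    using holomorphic_derivI[OF f \<open>open S\<close> sub[OF v]] by (simp add: has_field_derivative_def)
  then have "((\<lambda>v. f (g v)) has_derivative (\<lambda>u. deriv f (g v) * D u)) (at v)"
    by (rule has_derivative_compose[OF D(1)])
  moreover have "\<forall>c u. deriv f (g v) * D (c *s u) = c * (deriv f (g v) * D u)"
    by (simp add: D(2))
  ultimately show "\<exists>D. ((\<lambda>v. f (g v)) has_derivative D) (at v) \<and> (\<forall>c u. D (c *s u) = c * D u)"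
    by blast
qed

lemma mholomorphic_on_inverse:
  assumes "f mholomorphic_on U" and "\<And>v. v \<in> U \<Longrightarrow> f v \<noteq> 0"
  shows "(\<lambda>v. inverse (f v)) mholomorphic_on U"
proof (rule mholomorphic_on_holomorphic_compose[where S = "- {0}" and f = inverse])
  show "inverse holomorphic_on - {0 :: complex}"
    by (intro holomorphic_on_inverse holomorphic_on_ident) simp
qed (use assms in auto)

lemma has_derivative_vec_componentwise:
  fixes f :: "'a::real_normed_vector \<Rightarrow> ('b::euclidean_space) ^ 'm"
  assumes "\<And>j. ((\<lambda>v. f v $ j) has_derivative D j) (at v)"
  shows "(f has_derivative (\<lambda>u. \<chi> j. D j u)) (at v)"
proof (rule has_derivative_componentwise_within[THEN iffD2], rule ballI)
  fix b :: "'b ^ 'm" assume "b \<in> Basis"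
  then obtain j c where b: "b = axis j c"
    unfolding Basis_vec_def by blast
  show "((\<lambda>x. f x \<bullet> b) has_derivative (\<lambda>x. (\<chi> j. D j x) \<bullet> b)) (at v)"
    unfolding b inner_axis vec_lambda_beta
    by (rule has_derivative_inner_left[OF assms])
qed

lemma mholomorphic_on_imp_continuous_on:
  fixes \<phi> :: "complex ^ 'm \<Rightarrow> complex ^ 'l"
  assumes "\<And>j. (\<lambda>v. \<phi> v $ j) mholomorphic_on U"
  shows "continuous_on U \<phi>"
proof (rule continuous_at_imp_continuous_on, rule ballI)
  fix v assume "v \<in> U"
  then have "\<forall>j. \<exists>D. ((\<lambda>v. \<phi> v $ j) has_derivative D) (at v)"
    using assms unfolding mholomorphic_on_def by blast
  from choice[OF this] obtain D where "\<forall>j. ((\<lambda>v. \<phi> v $ j) has_derivative D j) (at v)" by blast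
  from has_derivative_vec_componentwise[OF this[rule_format]] show "isCont \<phi> v"
    by (rule has_derivative_continuous)
qed

lemma mholomorphic_on_compose:
  fixes \<phi> :: "complex ^ 'm \<Rightarrow> complex ^ 'l"
  assumes g: "g mholomorphic_on W" and \<phi>: "\<And>j. (\<lambda>v. \<phi> v $ j) mholomorphic_on U"
    and sub: "\<And>v. v \<in> U \<Longrightarrow> \<phi> v \<in> W"
  shows "(g \<circ> \<phi>) mholomorphic_on U"
  unfolding mholomorphic_on_def
proof
  fix v assume v: "v \<in> U"
  then have "\<forall>j. \<exists>D. ((\<lambda>v. \<phi> v $ j) has_derivative D) (at v) \<and> (\<forall>c u. D (c *s u) = c * D u)"
    using \<phi> unfolding mholomorphic_on_def by blast
  from choice[OF this] obtain D where D: "\<And>j. ((\<lambda>v. \<phi> v $ j) has_derivative D j) (at v)"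
    and linD: "\<And>j c u. D j (c *s u) = c * D j u" by blast
  obtain E where E: "(g has_derivative E) (at (\<phi> v))" and linE: "\<And>c u. E (c *s u) = c * E u"
    using g sub[OF v] unfolding mholomorphic_on_def by blast
  have "(g \<circ> \<phi> has_derivative (\<lambda>u. E (\<chi> j. D j u))) (at v)"
    using has_derivative_compose[OF has_derivative_vec_componentwise[OF D] E]
    by (simp add: comp_def)
  moreover have "E (\<chi> j. D j (c *s u)) = c * E (\<chi> j. D j u)" for c u
  proof -
    have "(\<chi> j. D j (c *s u)) = c *s (\<chi> j. D j u)"
      by (simp add: vec_eq_iff linD)
    then show ?thesis by (simp add: linE)
  qed
  ultimately show "\<exists>D. (g \<circ> \<phi> has_derivative D) (at v) \<and> (\<forall>c u. D (c *s u) = c * D u)"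
    by blast
qed

section \<open>Biholomorphic maps and isomorphisms of germs\<close>

lemma holomorphic_at_0I: "g mholomorphic_on U \<Longrightarrow> open U \<Longrightarrow> 0 \<in> U \<Longrightarrow> holomorphic_at_0 g"
  unfolding holomorphic_at_0_def by blast

lemma holomorphic_at_0_mult:
  assumes "holomorphic_at_0 f" and "holomorphic_at_0 g"
  shows "holomorphic_at_0 (\<lambda>v. f v * g v)"
proof -
  obtain U W where U: "open U" "0 \<in> U" "f mholomorphic_on U"
    and W: "open W" "0 \<in> W" "g mholomorphic_on W"
    using assms unfolding holomorphic_at_0_def by blast
  have "(\<lambda>v. f v * g v) mholomorphic_on U \<inter> W"
    by (intro mholomorphic_on_mult mholomorphic_on_subset[OF U(3)] mholomorphic_on_subset[OF W(3)])
      auto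
  then show ?thesis
    by (rule holomorphic_at_0I) (use U W in auto)
qed

lemma holomorphic_at_0_compose:
  fixes \<phi> :: "complex ^ 'm \<Rightarrow> complex ^ 'l"
  assumes g: "holomorphic_at_0 g" and "open U" and "0 \<in> U" and "\<phi> 0 = 0"
    and \<phi>: "\<And>j. (\<lambda>v. \<phi> v $ j) mholomorphic_on U"
  shows "holomorphic_at_0 (g \<circ> \<phi>)"
proof -
  obtain W where W: "open W" "0 \<in> W" "g mholomorphic_on W"
    using g unfolding holomorphic_at_0_def by blast
  define U' where "U' = U \<inter> \<phi> -` W"
  have "open U'"
    unfolding U'_def
    by (rule continuous_open_preimage[OF mholomorphic_on_imp_continuous_on[OF \<phi>] \<open>open U\<close> W(1)])
  moreover have "0 \<in> U'" using assms W by (simp add: U'_def)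
  moreover have "(g \<circ> \<phi>) mholomorphic_on U'"
    by (rule mholomorphic_on_compose[OF W(3) mholomorphic_on_subset[OF \<phi>]])
      (auto simp: U'_def)
  ultimately show ?thesis by (blast intro: holomorphic_at_0I)
qed

lemma biholomorphic_mapI:
  assumes "open U" and "open V"
    and \<phi>: "\<And>i. (\<lambda>v. \<phi> v $ i) mholomorphic_on U" and \<psi>: "\<And>i. (\<lambda>v. \<psi> v $ i) mholomorphic_on V"
    and "\<And>v. v \<in> U \<Longrightarrow> \<phi> v \<in> V" and "\<And>v. v \<in> V \<Longrightarrow> \<psi> v \<in> U"
    and "\<And>v. v \<in> U \<Longrightarrow> \<psi> (\<phi> v) = v" and "\<And>v. v \<in> V \<Longrightarrow> \<phi> (\<psi> v) = v"
  shows "biholomorphic_map U V \<phi>"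
proof -
  have bij: "bij_betw \<phi> U V"
    by (rule bij_betw_byWitness[where f' = \<psi>]) (use assms in auto)
  have "inv_into U \<phi> v = \<psi> v" if "v \<in> V" for v
    using assms that bij_betw_imp_inj_on[OF bij] by (metis inv_into_f_f)
  then have "(\<lambda>v. inv_into U \<phi> v $ i) mholomorphic_on V" for i
    by (intro mholomorphic_on_transform[OF \<psi> \<open>open V\<close>]) simp
  then show ?thesis
    unfolding biholomorphic_map_def using assms(1,2) \<phi> bij by blast
qed

text \<open>If \<open>G \<circ> \<phi> = e F\<close> with a unit \<open>e\<close>, then \<open>g = h G\<close> pulls back to \<open>g \<circ> \<phi> = (h \<circ> \<phi>) e F\<close>, and
  \<open>g \<circ> \<phi> = h F\<close> pushes forward to \<open>g = ((h / e) \<circ> \<phi>\<^sup>-\<^sup>1) G\<close>.\<close>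

lemma germ_isomorphic_if_pullback_unit_multiple:
  fixes F G e :: "complex ^ 'm \<Rightarrow> complex"
  assumes bih: "biholomorphic_map U V \<phi>" and "0 \<in> U" and "0 \<in> V" and "\<phi> 0 = 0"
    and e: "e mholomorphic_on U" and nz: "\<And>v. v \<in> U \<Longrightarrow> e v \<noteq> 0"
    and eq: "\<And>v. v \<in> U \<Longrightarrow> G (\<phi> v) = e v * F v"
  shows "germ_isomorphic (hypersurface_germ F) (hypersurface_germ G)"
proof -
  define \<psi> where "\<psi> = inv_into U \<phi>"
  have "open U" "open V" and bij: "bij_betw \<phi> U V"
    and \<phi>: "\<And>i. (\<lambda>v. \<phi> v $ i) mholomorphic_on U" and \<psi>: "\<And>i. (\<lambda>v. \<psi> v $ i) mholomorphic_on V"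
    using bih unfolding biholomorphic_map_def \<psi>_def by blast+
  have "\<psi> 0 = 0"
    using bij_betw_imp_inj_on[OF bij] \<open>0 \<in> U\<close> \<open>\<phi> 0 = 0\<close> unfolding \<psi>_def by (metis inv_into_f_f)
  have \<psi>_in: "\<psi> v \<in> U" and \<phi>\<psi>: "\<phi> (\<psi> v) = v" if "v \<in> V" for v
    using bij that unfolding \<psi>_def bij_betw_def by (auto simp: inv_into_into f_inv_into_f)
  have U: "\<forall>\<^sub>F v in nhds 0. v \<in> U" and V: "\<forall>\<^sub>F v in nhds 0. v \<in> V"
    using \<open>open U\<close> \<open>open V\<close> assms(2,3) by (auto simp: eventually_nhds)
  have "isCont \<phi> 0" "isCont \<psi> 0"
    using mholomorphic_on_imp_continuous_on[OF \<phi>] mholomorphic_on_imp_continuous_on[OF \<psi>]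
      \<open>open U\<close> \<open>open V\<close> assms(2,3) by (auto simp: continuous_on_eq_continuous_at)
  then have lim_\<phi>: "filterlim \<phi> (nhds 0) (nhds 0)" and lim_\<psi>: "filterlim \<psi> (nhds 0) (nhds 0)"
    using \<open>\<phi> 0 = 0\<close> \<open>\<psi> 0 = 0\<close> unfolding isCont_def tendsto_at_iff_tendsto_nhds by simp_all
  have hol_e: "holomorphic_at_0 e" "holomorphic_at_0 (\<lambda>v. inverse (e v))"
    using e mholomorphic_on_inverse[OF e nz] \<open>open U\<close> \<open>0 \<in> U\<close> by (auto intro: holomorphic_at_0I)
  have "g \<in> hypersurface_germ G \<longleftrightarrow> g \<circ> \<phi> \<in> hypersurface_germ F" if g: "holomorphic_at_0 g" for g
  proof
    assume "g \<in> hypersurface_germ G"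
    then obtain h where h: "holomorphic_at_0 h" and gh: "\<forall>\<^sub>F v in nhds 0. g v = h v * G v"
      unfolding hypersurface_germ_def by blast
    have "\<forall>\<^sub>F v in nhds 0. (g \<circ> \<phi>) v = ((h \<circ> \<phi>) v * e v) * F v"
      using U eventually_compose_filterlim[OF gh lim_\<phi>]
      by eventually_elim (simp add: eq)
    moreover have "holomorphic_at_0 (\<lambda>v. (h \<circ> \<phi>) v * e v)"
      by (intro holomorphic_at_0_mult holomorphic_at_0_compose[OF h \<open>open U\<close>] hol_e \<phi>
          \<open>0 \<in> U\<close> \<open>\<phi> 0 = 0\<close>)
    moreover have "holomorphic_at_0 (g \<circ> \<phi>)"
      by (intro holomorphic_at_0_compose[OF g \<open>open U\<close>] \<phi> \<open>0 \<in> U\<close> \<open>\<phi> 0 = 0\<close>)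
    ultimately show "g \<circ> \<phi> \<in> hypersurface_germ F"
      unfolding hypersurface_germ_def by blast
  next
    assume "g \<circ> \<phi> \<in> hypersurface_germ F"
    then obtain h where h: "holomorphic_at_0 h" and gh: "\<forall>\<^sub>F v in nhds 0. (g \<circ> \<phi>) v = h v * F v"
      unfolding hypersurface_germ_def by blast
    define k where "k = (\<lambda>v. h v * inverse (e v)) \<circ> \<psi>"
    have "\<forall>\<^sub>F v in nhds 0. g v = k v * G v"
      using V eventually_compose_filterlim[OF gh lim_\<psi>]
    proof eventually_elim
      case (elim v)
      have "G v = e (\<psi> v) * F (\<psi> v)"
        using eq[OF \<psi>_in[OF elim(1)]] by (simp add: \<phi>\<psi>[OF elim(1)])
      then show ?case
        using elim(2) nz[OF \<psi>_in[OF elim(1)]] by (simp add: k_def \<phi>\<psi>[OF elim(1)])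
    qed
    moreover have "holomorphic_at_0 k"
      unfolding k_def
      by (intro holomorphic_at_0_compose[OF _ \<open>open V\<close>] holomorphic_at_0_mult h hol_e \<psi>
          \<open>0 \<in> V\<close> \<open>\<psi> 0 = 0\<close>)
    ultimately show "g \<in> hypersurface_germ G"
      unfolding hypersurface_germ_def using g by blast
  qed
  then show ?thesis
    unfolding germ_isomorphic_def using assms(2-4) bih by blast
qed

lemma germ_isomorphic_refl: "germ_isomorphic (hypersurface_germ F) (hypersurface_germ F)"
proof (rule germ_isomorphic_if_pullback_unit_multiple[where U = UNIV and V = UNIV and \<phi> = "\<lambda>v. v"])
  show "biholomorphic_map UNIV UNIV (\<lambda>v. v)"
    by (rule biholomorphic_mapI[where \<psi> = "\<lambda>v. v"]) (auto intro: mholomorphic_on_component)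
  show "(\<lambda>_. 1) mholomorphic_on UNIV"
    by (rule mholomorphic_onI[where D = "\<lambda>_ _. 0"]) auto
qed auto

text \<open>The inverse divides the other coordinates by the factors taken at the preimage of the base
  coordinate, so it has the same shape and is holomorphic for the same reason.\<close>

lemma biholomorphic_fibred_scaling:
  fixes k :: "'m::finite" and c :: "'m \<Rightarrow> complex \<Rightarrow> complex"
  assumes "open D" and "open E"
    and \<tau>: "\<tau> holomorphic_on D" and \<kappa>: "\<kappa> holomorphic_on E"
    and maps: "\<And>w. w \<in> D \<Longrightarrow> \<tau> w \<in> E" "\<And>w. w \<in> E \<Longrightarrow> \<kappa> w \<in> D"
    and inv: "\<And>w. w \<in> D \<Longrightarrow> \<kappa> (\<tau> w) = w" "\<And>w. w \<in> E \<Longrightarrow> \<tau> (\<kappa> w) = w"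
    and c: "\<And>i. c i holomorphic_on D" and nz: "\<And>i w. w \<in> D \<Longrightarrow> c i w \<noteq> 0"
  shows "biholomorphic_map {v. v $ k \<in> D} {v. v $ k \<in> E}
           (\<lambda>v. \<chi> i. if i = k then \<tau> (v $ k) else c i (v $ k) * v $ i)"
    (is "biholomorphic_map ?U ?V ?\<phi>")
proof (rule biholomorphic_mapI)
  let ?\<psi> = "\<lambda>v. \<chi> i. if i = k then \<kappa> (v $ k) else inverse (c i (\<kappa> (v $ k))) * v $ i"
  have "open {v::complex ^ 'm. v $ k \<in> T}" if "open T" for T
    using open_vimage_vec_nth[OF that, of k] by (simp add: vimage_def)
  then show "open ?U" "open ?V" using \<open>open D\<close> \<open>open E\<close> by blast+
  have base: "(\<lambda>v. f (v $ k)) mholomorphic_on {v. v $ k \<in> T}"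
    if "f holomorphic_on T" "open T" for f T
    by (rule mholomorphic_on_holomorphic_compose[OF that mholomorphic_on_component]) simp
  show "(\<lambda>v. ?\<phi> v $ i) mholomorphic_on ?U" for i
    by (cases "i = k")
      (auto intro!: base mholomorphic_on_mult mholomorphic_on_component \<tau> c \<open>open D\<close>)
  have "(\<lambda>w. inverse (c i (\<kappa> w))) holomorphic_on E" for i
    using holomorphic_on_compose_gen[OF \<kappa> c, of i] maps nz
    by (auto intro!: holomorphic_on_inverse simp: comp_def image_subset_iff)
  note inverse_factors = base[OF this \<open>open E\<close>]
  show "(\<lambda>v. ?\<psi> v $ i) mholomorphic_on ?V" for i
    by (cases "i = k")
      (auto intro!: inverse_factors base[OF \<kappa> \<open>open E\<close>] mholomorphic_on_mult
        mholomorphic_on_component)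
  show "?\<psi> (?\<phi> v) = v" if "v \<in> ?U" for v
    using that nz by (auto simp: vec_eq_iff inv)
  show "?\<phi> (?\<psi> v) = v" if "v \<in> ?V" for v
    using that nz maps by (auto simp: vec_eq_iff inv)
qed (use maps in auto)

section \<open>Matching two units by a change of one variable\<close>

text \<open>The function \<open>s\<close> is the power of \<open>v\<close> with exponent \<open>1/(a - b)\<close>, formed with a logarithm of
  \<open>v\<close>. Natural exponents on both sides avoid a case distinction on the sign of \<open>a - b\<close>. The
  derivative of \<open>w s(w)\<^sup>d\<close> at \<open>0\<close> is \<open>s(0)\<^sup>d \<noteq> 0\<close>, which makes it a local coordinate.\<close>

lemma unit_root_coordinate:
  fixes v :: "complex \<Rightarrow> complex" and a b d :: nat
  assumes v: "v holomorphic_on UNIV" and "v 0 \<noteq> 0" and "a \<noteq> b"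
  obtains B s where "open B" and "0 \<in> B" and "s holomorphic_on B" and "\<And>w. w \<in> B \<Longrightarrow> s w \<noteq> 0"
    and "\<And>w. w \<in> B \<Longrightarrow> s w ^ a = s w ^ b * v w" and "inj_on (\<lambda>w. w * s w ^ d) B"
proof -
  have "isCont v 0"
    using holomorphic_on_imp_continuous_on[OF v] by (simp add: continuous_on_eq_continuous_at)
  then obtain \<epsilon> where "\<epsilon> > 0" and nz: "\<And>w. dist 0 w < \<epsilon> \<Longrightarrow> v w \<noteq> 0"
    using continuous_at_avoid \<open>v 0 \<noteq> 0\<close> by blast
  obtain g where g: "g holomorphic_on ball 0 \<epsilon>" and exp_g: "\<And>w. w \<in> ball 0 \<epsilon> \<Longrightarrow> exp (g w) = v w"
  proof (rule holomorphic_logarithm_exists[of "ball 0 \<epsilon>" v 0])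
    show "v holomorphic_on ball 0 \<epsilon>" using v by (rule holomorphic_on_subset) simp
  qed (use \<open>\<epsilon> > 0\<close> nz in auto)
  define m :: complex where "m = of_nat a - of_nat b"
  have "m \<noteq> 0" using \<open>a \<noteq> b\<close> by (simp add: m_def)
  define s where "s = (\<lambda>w. exp (g w / m))"
  have s: "s holomorphic_on ball 0 \<epsilon>"
    unfolding s_def by (intro holomorphic_intros g) (use \<open>m \<noteq> 0\<close> in auto)
  have root: "s w ^ a = s w ^ b * v w" if "w \<in> ball 0 \<epsilon>" for w
  proof -
    have "of_nat a * (g w / m) = of_nat b * (g w / m) + g w"
      using \<open>m \<noteq> 0\<close> by (simp add: m_def field_simps)
    then show ?thesis
      by (simp add: s_def exp_g[OF that] flip: exp_of_nat_mult exp_add)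
        (simp add: exp_add exp_g[OF that])
  qed
  let ?f = "\<lambda>w. w * s w ^ d"
  have f: "?f holomorphic_on ball 0 \<epsilon>" by (intro holomorphic_intros s)
  have "((\<lambda>w. s w ^ d) has_field_derivative deriv (\<lambda>w. s w ^ d) 0) (at 0)"
    by (rule holomorphic_derivI[of _ "ball 0 \<epsilon>"]) (use \<open>\<epsilon> > 0\<close> in \<open>auto intro!: holomorphic_intros s\<close>)
  from DERIV_mult[OF DERIV_ident this] have "deriv ?f 0 = s 0 ^ d"
    by (intro DERIV_imp_deriv) simp
  then have deriv_nz: "deriv ?f 0 \<noteq> 0" by (simp add: s_def)
  obtain \<delta> where "\<delta> > 0" and \<delta>: "ball (0 :: complex) \<delta> \<subseteq> ball 0 \<epsilon>" "inj_on ?f (ball 0 \<delta>)"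
  proof (rule has_complex_derivative_locally_injective[OF f _ open_ball deriv_nz])
    show "0 \<in> ball (0 :: complex) \<epsilon>" using \<open>\<epsilon> > 0\<close> by simp
  qed (rule that)
  show thesis
  proof (rule that[of "ball 0 \<delta>" s])
    show "s holomorphic_on ball 0 \<delta>" by (rule holomorphic_on_subset[OF s \<delta>(1)])
    show "s w ^ a = s w ^ b * v w" if "w \<in> ball 0 \<delta>" for w using root \<delta>(1) that by blast
  qed (use \<open>\<delta> > 0\<close> \<delta>(2) in \<open>simp_all add: s_def\<close>)
qed

text \<open>With \<open>s\<close>, \<open>s'\<close> as above for \<open>v\<close>, \<open>v'\<close>, the map \<open>\<tau>\<close> identifies the points with equal
  coordinate: \<open>\<tau>(w) s'(\<tau>(w))\<^sup>d = w s(w)\<^sup>d\<close>. Then \<open>r(w) = s(w) / s'(\<tau>(w))\<close> is the solution, since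
  \<open>r\<^sup>a / r\<^sup>b = v(w) / v'(\<tau>(w))\<close>.\<close>

lemma unit_matching_coordinate_change:
  fixes v v' :: "complex \<Rightarrow> complex" and a b d :: nat
  assumes "v holomorphic_on UNIV" and "v 0 \<noteq> 0" and "v' holomorphic_on UNIV" and "v' 0 \<noteq> 0"
    and "a \<noteq> b"
  obtains D E \<tau> \<kappa> r where "open D" and "open E" and "0 \<in> D"
    and "\<tau> holomorphic_on D" and "\<kappa> holomorphic_on E"
    and "\<And>w. w \<in> D \<Longrightarrow> \<tau> w \<in> E" and "\<And>w. w \<in> E \<Longrightarrow> \<kappa> w \<in> D"
    and "\<And>w. w \<in> D \<Longrightarrow> \<kappa> (\<tau> w) = w" and "\<And>w. w \<in> E \<Longrightarrow> \<tau> (\<kappa> w) = w"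
    and "r holomorphic_on D" and "\<And>w. w \<in> D \<Longrightarrow> r w \<noteq> 0"
    and "\<And>w. w \<in> D \<Longrightarrow> \<tau> w = w * r w ^ d"
    and "\<And>w. w \<in> D \<Longrightarrow> r w ^ a * v' (\<tau> w) = r w ^ b * v w"
proof -
  obtain B s where B: "open B" "0 \<in> B" and s: "s holomorphic_on B" "\<And>w. w \<in> B \<Longrightarrow> s w \<noteq> 0"
    and root: "\<And>w. w \<in> B \<Longrightarrow> s w ^ a = s w ^ b * v w" and "inj_on (\<lambda>w. w * s w ^ d) B"
    by (rule unit_root_coordinate[OF assms(1,2,5), where d = d]) (rule that)
  obtain B' s' where B': "open B'" "0 \<in> B'" and s': "s' holomorphic_on B'" "\<And>w. w \<in> B' \<Longrightarrow> s' w \<noteq> 0"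
    and root': "\<And>w. w \<in> B' \<Longrightarrow> s' w ^ a = s' w ^ b * v' w" and "inj_on (\<lambda>w. w * s' w ^ d) B'"
    by (rule unit_root_coordinate[OF assms(3,4,5), where d = d]) (rule that)
  define f where "f = (\<lambda>w. w * s w ^ d)"
  define f' where "f' = (\<lambda>w. w * s' w ^ d)"
  have inj: "inj_on f B" "inj_on f' B'" unfolding f_def f'_def by fact+
  have f: "f holomorphic_on B" unfolding f_def by (intro holomorphic_intros s)
  have f': "f' holomorphic_on B'" unfolding f'_def by (intro holomorphic_intros s')
  obtain \<gamma> where \<gamma>: "\<gamma> holomorphic_on f ` B" "\<And>w. w \<in> B \<Longrightarrow> \<gamma> (f w) = w"
    using holomorphic_has_inverse[OF f B(1) inj(1)] by metis
  obtain \<gamma>' where \<gamma>': "\<gamma>' holomorphic_on f' ` B'" "\<And>w. w \<in> B' \<Longrightarrow> \<gamma>' (f' w) = w"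
    using holomorphic_has_inverse[OF f' B'(1) inj(2)] by metis
  have op: "open (f ` B)" "open (f' ` B')"
    using open_mapping_thm3[OF f B(1) inj(1)] open_mapping_thm3[OF f' B'(1) inj(2)] by auto
  define D where "D = B \<inter> f -` (f' ` B')"
  define E where "E = B' \<inter> f' -` (f ` B)"
  define \<tau> where "\<tau> = \<gamma>' \<circ> f"
  define \<kappa> where "\<kappa> = \<gamma> \<circ> f'"
  define r where "r = (\<lambda>w. s w / s' (\<tau> w))"
  have "open D" "open E"
    unfolding D_def E_def using f f' B B' op
    by (auto intro!: continuous_open_preimage holomorphic_on_imp_continuous_on)
  have "0 \<in> D" using B B' by (auto simp: D_def f_def f'_def intro!: image_eqI[of _ _ 0])
  have \<tau>: "\<tau> holomorphic_on D"
    unfolding \<tau>_def D_def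
    by (rule holomorphic_on_compose_gen[OF holomorphic_on_subset[OF f] \<gamma>'(1)]) auto
  have \<kappa>: "\<kappa> holomorphic_on E"
    unfolding \<kappa>_def E_def
    by (rule holomorphic_on_compose_gen[OF holomorphic_on_subset[OF f'] \<gamma>(1)]) auto
  have f'\<tau>: "f' (\<tau> w) = f w" if "w \<in> D" for w
    using that by (auto simp: D_def \<tau>_def \<gamma>')
  have \<tau>_in: "\<tau> w \<in> E" if w: "w \<in> D" for w
  proof -
    obtain u where u: "w \<in> B" "u \<in> B'" "f w = f' u" using w unfolding D_def by blast
    then have "\<tau> w = u" by (simp add: \<tau>_def \<gamma>'(2))
    then show ?thesis using u imageI[OF u(1), of f] by (simp add: E_def)
  qed
  have f\<kappa>: "f (\<kappa> w) = f' w" if "w \<in> E" for w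
    using that by (auto simp: E_def \<kappa>_def \<gamma>)
  have \<kappa>_in: "\<kappa> w \<in> D" if w: "w \<in> E" for w
  proof -
    obtain u where u: "w \<in> B'" "u \<in> B" "f' w = f u" using w unfolding E_def by blast
    then have "\<kappa> w = u" by (simp add: \<kappa>_def \<gamma>(2))
    then show ?thesis using u imageI[OF u(1), of f'] by (simp add: D_def)
  qed
  have DB: "D \<subseteq> B" and EB: "E \<subseteq> B'" by (auto simp: D_def E_def)
  have nz: "s w \<noteq> 0" "s' (\<tau> w) \<noteq> 0" if "w \<in> D" for w
    using that s(2) s'(2) \<tau>_in DB EB by blast+
  have "(\<lambda>w. s' (\<tau> w)) holomorphic_on D"
    using holomorphic_on_compose_gen[OF \<tau> s'(1)] \<tau>_in EB by (auto simp: comp_def)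
  then have r: "r holomorphic_on D"
    unfolding r_def using nz by (intro holomorphic_intros holomorphic_on_subset[OF s(1) DB]) auto
  show thesis
  proof (rule that[OF \<open>open D\<close> \<open>open E\<close> \<open>0 \<in> D\<close> \<tau> \<kappa> \<tau>_in \<kappa>_in _ _ r])
    fix w assume w: "w \<in> D"
    show "\<kappa> (\<tau> w) = w"
      using w DB f'\<tau>[OF w] \<gamma>(2) by (auto simp: \<kappa>_def)
    show "r w \<noteq> 0" using nz[OF w] by (simp add: r_def)
    show "\<tau> w = w * r w ^ d"
      using f'\<tau>[OF w] nz[OF w] by (simp add: f_def f'_def r_def power_divide eq_divide_eq)
    show "r w ^ a * v' (\<tau> w) = r w ^ b * v w"
    proof -
      have "s' (\<tau> w) ^ a = s' (\<tau> w) ^ b * v' (\<tau> w)" using root' \<tau>_in[OF w] EB by blast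
      moreover have "s w ^ a = s w ^ b * v w" using root w DB by blast
      moreover have "s' (\<tau> w) ^ a \<noteq> 0" using nz[OF w] by simp
      ultimately show ?thesis by (simp add: r_def power_divide)
    qed
  next
    fix w assume w: "w \<in> E"
    show "\<tau> (\<kappa> w) = w"
      using w EB f\<kappa>[OF w] \<gamma>'(2) by (auto simp: \<tau>_def)
  qed
qed

section \<open>The family of hypersurfaces\<close>

lemma F_fam_factorization:
  "F_fam n l v = (v $ 1) ^ 2 + (v $ 3) ^ 2 * v $ 4
     + (v $ 2 + (\<Sum>j = 1..2 * n. l j * (- v $ 4) ^ j)) * ((v $ 2) ^ 2 + (v $ 4) ^ (2 * n + 1))"
proof -
  define p where "p w = (\<Sum>j = 1..2 * n. l j * (- w) ^ j)" for w
  have "(- w) ^ (j + 2 * n + 1) = - (w ^ (2 * n + 1) * (- w) ^ j)" for w :: complex and j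
    by (simp add: power_add power_mult)
  then have "(\<Sum>j = 1..2 * n. l j * (- w) ^ (j + 2 * n + 1)) = - (w ^ (2 * n + 1) * p w)" for w
    by (simp only: p_def sum_distrib_left mult_minus_right sum_negf mult.left_commute)
  moreover have "(\<Sum>j = 1..2 * n. l j * y ^ 2 * (- w) ^ j) = y ^ 2 * p w" for w y :: complex
    by (simp add: p_def sum_distrib_left mult_ac)
  ultimately show ?thesis
    unfolding F_fam_def Let_def p_def[symmetric]
    by (simp only:) (simp add: algebra_simps power2_eq_square power3_eq_cube)
qed

text \<open>The stratum prescribes the order of vanishing of \<open>p\<close> at \<open>0\<close>: every index \<open>j\<close> with
  \<open>l j \<noteq> 0\<close> is at least \<open>i\<close>, and the term of index \<open>i\<close> alone contributes to \<open>v(0)\<close>.\<close>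

lemma stratum_unit_factor:
  assumes l: "l \<in> stratum n i" and "i > 0"
  obtains v where "v holomorphic_on UNIV" and "v 0 \<noteq> 0"
    and "\<And>w. (\<Sum>j = 1..2 * n. l j * (- w) ^ j) = w ^ i * v w"
proof -
  define J where "J = {j \<in> {1..2 * n}. l j \<noteq> 0}"
  have "finite J" "J \<noteq> {}" "Min J = i"
    using l \<open>i > 0\<close> by (auto simp: stratum_def J_def)
  then have "i \<in> J" and min: "\<And>j. j \<in> J \<Longrightarrow> i \<le> j"
    using Min_in Min_le by blast+
  define v where "v = (\<lambda>w. \<Sum>j\<in>J. l j * (- 1) ^ j * w ^ (j - i))"
  have "v holomorphic_on UNIV" unfolding v_def by (intro holomorphic_intros)
  moreover have "v 0 = (\<Sum>j\<in>J. if j = i then l j * (- 1) ^ j else 0)"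
    unfolding v_def by (rule sum.cong) (use min in \<open>auto simp: power_0_left dest!: min\<close>)
  then have "v 0 = l i * (- 1) ^ i"
    using \<open>finite J\<close> \<open>i \<in> J\<close> by simp
  then have "v 0 \<noteq> 0" using \<open>i \<in> J\<close> by (simp add: J_def)
  moreover have "(\<Sum>j = 1..2 * n. l j * (- w) ^ j) = w ^ i * v w" for w
  proof -
    have "(\<Sum>j = 1..2 * n. l j * (- w) ^ j) = (\<Sum>j\<in>J. l j * (- w) ^ j)"
      by (rule sum.mono_neutral_right) (auto simp: J_def)
    also have "\<dots> = (\<Sum>j\<in>J. w ^ i * (l j * (- 1) ^ j * w ^ (j - i)))"
    proof (rule sum.cong)
      fix j assume "j \<in> J"
      then have "w ^ j = w ^ i * w ^ (j - i)" using min by (simp flip: power_add)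
      then show "l j * (- w) ^ j = w ^ i * (l j * (- 1) ^ j * w ^ (j - i))"
        by (simp add: power_minus[of w])
    qed simp
    finally show ?thesis by (simp add: v_def sum_distrib_left)
  qed
  ultimately show thesis by (rule that)
qed

text \<open>The weights of \<open>x\<close>, \<open>y\<close>, \<open>z\<close>, \<open>w\<close> are \<open>3N\<close>, \<open>2N\<close>, \<open>3N - 2\<close>, \<open>4\<close>. The hypothesis on \<open>q\<close> is
  the condition \<open>p'(w r\<^sup>4) = r\<^bsup>2N\<^esup> p(w)\<close>, which says that \<open>p\<close> transforms like \<open>y\<close>.\<close>

lemma weighted_scaling:
  fixes x y z w r p q :: complex
  assumes "N \<ge> 1" and "q = r ^ (2 * N) * p"
  shows "(r ^ (3 * N) * x)\<^sup>2 + (r ^ (3 * N - 2) * z)\<^sup>2 * (w * r ^ 4)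
           + (r ^ (2 * N) * y + q) * ((r ^ (2 * N) * y)\<^sup>2 + (w * r ^ 4) ^ N)
       = r ^ (6 * N) * (x\<^sup>2 + z\<^sup>2 * w + (y + p) * (y\<^sup>2 + w ^ N))"
proof -
  have regroup: "a * x\<^sup>2 + b * z\<^sup>2 * (w * c) + (d * y + d * p) * (f * y\<^sup>2 + u * g)
      = h * (x\<^sup>2 + z\<^sup>2 * w + (y + p) * (y\<^sup>2 + u))"
    if "a = h" "g = f" "b * c = h" "d * f = h" for a b c d f g h u :: complex
  proof -
    have "b * z\<^sup>2 * (w * c) = (b * c) * (z\<^sup>2 * w)"
      "(d * y + d * p) * (f * y\<^sup>2 + u * f) = (d * f) * ((y + p) * (y\<^sup>2 + u))"
      by (simp_all add: algebra_simps)
    then show ?thesis using that by (simp add: algebra_simps)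
  qed
  have "(r ^ (3 * N))\<^sup>2 = r ^ (6 * N)" "(r ^ 4) ^ N = r ^ (4 * N)" "(r ^ (2 * N))\<^sup>2 = r ^ (4 * N)"
    by (simp_all flip: power_mult add: mult.commute)
  moreover have "(r ^ (3 * N - 2))\<^sup>2 * r ^ 4 = r ^ (6 * N)"
  proof -
    have "(3 * N - 2) * 2 + 4 = 6 * N" using \<open>N \<ge> 1\<close> by simp
    then show ?thesis by (simp flip: power_mult power_add)
  qed
  moreover have "r ^ (2 * N) * r ^ (4 * N) = r ^ (6 * N)"
    by (simp flip: power_add)
  ultimately show ?thesis
    unfolding assms(2) power_mult_distrib by (intro regroup) simp_all
qed

theorem theorem5p2:
  fixes n i :: nat and l l' :: "nat \<Rightarrow> complex"
  assumes "n \<ge> 1" and "i \<le> 2 * n"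
    and "l \<in> stratum n i" and "l' \<in> stratum n i"
  shows "germ_isomorphic (X_fam n l) (X_fam n l')"
proof (cases "i = 0")
  case True
  then have "F_fam n l = F_fam n l'"
    using assms(3,4) by (auto simp: F_fam_factorization stratum_def fun_eq_iff)
  then show ?thesis by (simp add: X_fam_def germ_isomorphic_refl)
next
  case False
  define N where "N = 2 * n + 1"
  obtain v where v: "v holomorphic_on UNIV" "v 0 \<noteq> 0"
    and p: "\<And>w. (\<Sum>j = 1..2 * n. l j * (- w) ^ j) = w ^ i * v w"
    by (rule stratum_unit_factor[OF assms(3)]) (use False in auto)
  obtain v' where v': "v' holomorphic_on UNIV" "v' 0 \<noteq> 0"
    and p': "\<And>w. (\<Sum>j = 1..2 * n. l' j * (- w) ^ j) = w ^ i * v' w"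
    by (rule stratum_unit_factor[OF assms(4)]) (use False in auto)
  have "4 * i \<noteq> 2 * N" unfolding N_def by presburger
  then obtain D E \<tau> \<kappa> r where DE: "open D" "open E" "0 \<in> D"
    and hol: "\<tau> holomorphic_on D" "\<kappa> holomorphic_on E"
    and maps: "\<And>w. w \<in> D \<Longrightarrow> \<tau> w \<in> E" "\<And>w. w \<in> E \<Longrightarrow> \<kappa> w \<in> D"
    and inv: "\<And>w. w \<in> D \<Longrightarrow> \<kappa> (\<tau> w) = w" "\<And>w. w \<in> E \<Longrightarrow> \<tau> (\<kappa> w) = w"
    and r: "r holomorphic_on D" "\<And>w. w \<in> D \<Longrightarrow> r w \<noteq> 0"
    and \<tau>: "\<And>w. w \<in> D \<Longrightarrow> \<tau> w = w * r w ^ 4"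
    and match: "\<And>w. w \<in> D \<Longrightarrow> r w ^ (4 * i) * v' (\<tau> w) = r w ^ (2 * N) * v w"
    by (rule unit_matching_coordinate_change[OF v v', where d = 4]) (rule that)
  \<comment> \<open>The coordinate \<open>w\<close> of index 4 transforms by \<open>\<tau>\<close>; the value of \<open>m\<close> there is a default.\<close>
  define m :: "4 \<Rightarrow> nat" where
    "m = (\<lambda>j. if j = 1 then 3 * N else if j = 2 then 2 * N else 3 * N - 2)"
  define \<phi> :: "complex ^ 4 \<Rightarrow> complex ^ 4" where
    "\<phi> = (\<lambda>u. \<chi> j. if j = 4 then \<tau> (u $ 4) else r (u $ 4) ^ m j * u $ j)"
  define U :: "(complex ^ 4) set" where "U = {u. u $ 4 \<in> D}"
  have bih: "biholomorphic_map U {u. u $ 4 \<in> E} \<phi>"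
    unfolding U_def \<phi>_def
    by (rule biholomorphic_fibred_scaling[where c = "\<lambda>j w. r w ^ m j", OF DE(1,2) hol maps inv])
      (simp_all add: r holomorphic_on_power)
  have "\<tau> 0 = 0" using \<tau>[OF DE(3)] by simp
  have "(\<lambda>w. r w ^ (6 * N)) holomorphic_on D" by (intro holomorphic_intros r)
  then have unit: "(\<lambda>u. r (u $ 4) ^ (6 * N)) mholomorphic_on U"
    by (rule mholomorphic_on_holomorphic_compose[OF _ DE(1) mholomorphic_on_component])
      (simp add: U_def)
  have "F_fam n l' (\<phi> u) = r (u $ 4) ^ (6 * N) * F_fam n l u" if "u \<in> U" for u
  proof -
    define w where "w = u $ 4"
    have w: "w \<in> D" using that by (simp add: U_def w_def)
    have "\<tau> w ^ i * v' (\<tau> w) = w ^ i * (r w ^ (4 * i) * v' (\<tau> w))"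
      unfolding \<tau>[OF w] by (simp only: power_mult_distrib power_mult mult.assoc)
    also have "\<dots> = r w ^ (2 * N) * (w ^ i * v w)"
      unfolding match[OF w] by (rule mult.left_commute)
    finally have transform: "(w * r w ^ 4) ^ i * v' (w * r w ^ 4) = r w ^ (2 * N) * (w ^ i * v w)"
      unfolding \<tau>[OF w] .
    have \<phi>: "\<phi> u $ 1 = r w ^ (3 * N) * u $ 1" "\<phi> u $ 2 = r w ^ (2 * N) * u $ 2"
      "\<phi> u $ 3 = r w ^ (3 * N - 2) * u $ 3" "\<phi> u $ 4 = w * r w ^ 4"
      using \<tau>[OF w] by (simp_all add: \<phi>_def m_def w_def)
    have "N \<ge> 1" by (simp add: N_def)
    show ?thesis
      unfolding F_fam_factorization p p' \<phi> w_def[symmetric] N_def[symmetric]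
      by (rule weighted_scaling[OF \<open>N \<ge> 1\<close> transform])
  qed
  then show ?thesis
    unfolding X_fam_def
  proof (rule germ_isomorphic_if_pullback_unit_multiple[OF bih _ _ _ unit, rotated 4])
    show "0 \<in> U" using DE(3) by (simp add: U_def)
    show "0 \<in> {u :: complex ^ 4. u $ 4 \<in> E}" using maps(1)[OF DE(3)] \<open>\<tau> 0 = 0\<close> by simp
    show "\<phi> 0 = 0" using \<open>\<tau> 0 = 0\<close> by (simp add: \<phi>_def vec_eq_iff)
    show "r (u $ 4) ^ (6 * N) \<noteq> 0" if "u \<in> U" for u using r(2) that by (simp add: U_def)
  qed
qed

end
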